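(* Let $m\ge 2$ be an integer and let $G$ be a finite group. If $G$ is $m$DCI, $m$CI, $m$PDCI or $m$PCI, then $G$ is $(m-1)$DCI, $(m-1)$CI, $(m-1)$PDCI or $(m-1)$PCI, respectively.
   Context: Digraphs are finite without loops or multiple arcs; a graph is a digraph with symmetric arc set. Let $k$ be a positive integer and let $V=\bigcup_{i=1}^k G_i$ be a disjoint union of copies $G_i=\{x_i:x\in G\}$ of $G$. For subsets $S_{i,j}\subseteq G$ ($1\le i,j\le k$) with $1\notin S_{i,i}$, the $k$-Cayley digraph $\mathrm{Cay}(G,S_{i,j}:1\le i,j\le k)$ has vertex set $V$ and arc set $\bigcup_{i,j}\{(x_i,(sx)_j): s\in S_{i,j},x\in G\}$; it is a $k$-Cayley graph if it is a graph. It is a $k$-PCayley digraph (graph) if in addition $S_{i,i}=\emptyset$ for all $i$. $R(G)=\{R(g):g\in G\}$ with $R(g):x_i\mapsto(xg)_i$ for all $x\in G$ and all $i$, and $N=N_{\mathrm{S}_V}(R(G))$ is its normalizer in the symmetric group on $V$. For a permutation $n$ of $V$, $\Gamma^n$ is the digraph with vertex set $V$ and arcs $(u^n,v^n)$ for $(u,v)$ an arc of $\Gamma$. A $k$-Cayley (di)graph $\Gamma$ of $G$ is $k$CI if for every $k$-Cayley (di)graph $\Sigma$ of $G$ isomorphic to $\Gamma$ there is $n\in N$ with $\Gamma^n=\Sigma$. A $k$-PCayley (di)graph $\Gamma$ of $G$ is $k$PCI if for every $k$-PCayley (di)graph $\Sigma$ of $G$ for which there is an isomorphism from $\Gamma$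 to $\Sigma$ mapping each $G_i$ onto some $G_j$, there is $n\in N$ with $\Gamma^n=\Sigma$. The group $G$ is $k$DCI (resp. $k$CI) if every $k$-Cayley digraph (resp. graph) of $G$ is $k$CI, and $k$PDCI (resp. $k$PCI) if every $k$-PCayley digraph (resp. graph) of $G$ is $k$PCI. *)

theory Defs
  imports
    "HOL-Algebra.Bij"
    "HOL-Algebra.Group_Action"
    "Graph_Theory.Pair_Digraph"
    "Graph_Theory.Digraph_Isomorphism"
begin

text \<open>The element \<open>x\<^sub>i\<close> of the \<open>i\<close>-th copy of \<open>G\<close> is encoded as the pair \<open>(x, i)\<close>.\<close>

definition copy :: "('a, 'b) monoid_scheme \<Rightarrow> nat \<Rightarrow> ('a \<times> nat) set" where
  "copy G i = carrier G \<times> {i}"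

definition copies :: "('a, 'b) monoid_scheme \<Rightarrow> nat \<Rightarrow> ('a \<times> nat) set" where
  "copies G k = (\<Union>i\<in>{1..k}. copy G i)"

definition Cay ::
  "('a, 'b) monoid_scheme \<Rightarrow> nat \<Rightarrow> (nat \<Rightarrow> nat \<Rightarrow> 'a set) \<Rightarrow> ('a \<times> nat) pair_pre_digraph" where
  "Cay G k S =
    \<lparr> pverts = copies G k,
      parcs = (\<Union>i\<in>{1..k}. \<Union>j\<in>{1..k}. {((x, i), (s \<otimes>\<^bsub>G\<^esub> x, j)) | s x. s \<in> S i j \<and> x \<in> carrier G}) \<rparr>"

definition cayley_digraphs ::
  "('a, 'b) monoid_scheme \<Rightarrow> nat \<Rightarrow> ('a \<times> nat) pair_pre_digraph set" where
  "cayley_digraphs G k =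
    {Cay G k S | S. (\<forall>i\<in>{1..k}. \<forall>j\<in>{1..k}. S i j \<subseteq> carrier G) \<and>
                    (\<forall>i\<in>{1..k}. \<one>\<^bsub>G\<^esub> \<notin> S i i)}"

definition cayley_graphs ::
  "('a, 'b) monoid_scheme \<Rightarrow> nat \<Rightarrow> ('a \<times> nat) pair_pre_digraph set" where
  "cayley_graphs G k = {\<Gamma> \<in> cayley_digraphs G k. symmetric (with_proj \<Gamma>)}"

definition pcayley_digraphs ::
  "('a, 'b) monoid_scheme \<Rightarrow> nat \<Rightarrow> ('a \<times> nat) pair_pre_digraph set" where
  "pcayley_digraphs G k =
    {Cay G k S | S. (\<forall>i\<in>{1..k}. \<forall>j\<in>{1..k}. S i j \<subseteq> carrier G) \<and>
                    (\<forall>i\<in>{1..k}. S i i = {})}"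

definition pcayley_graphs ::
  "('a, 'b) monoid_scheme \<Rightarrow> nat \<Rightarrow> ('a \<times> nat) pair_pre_digraph set" where
  "pcayley_graphs G k = {\<Gamma> \<in> pcayley_digraphs G k. symmetric (with_proj \<Gamma>)}"

text \<open>The symmetric group on a set \<open>V\<close> is \<^term>\<open>BijGroup V\<close>, whose elements are
  extensional functions; hence the restriction to \<^const>\<open>copies\<close>.\<close>

definition right_translation ::
  "('a, 'b) monoid_scheme \<Rightarrow> nat \<Rightarrow> 'a \<Rightarrow> 'a \<times> nat \<Rightarrow> 'a \<times> nat" where
  "right_translation G k g = (\<lambda>(x, i)\<in>copies G k. (x \<otimes>\<^bsub>G\<^esub> g, i))"

definition right_regular ::
  "('a, 'b) monoid_scheme \<Rightarrow> nat \<Rightarrow> ('a \<times> nat \<Rightarrow> 'a \<times> nat) set" where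
  "right_regular G k = right_translation G k ` carrier G"

definition regular_normalizer ::
  "('a, 'b) monoid_scheme \<Rightarrow> nat \<Rightarrow> ('a \<times> nat \<Rightarrow> 'a \<times> nat) set" where
  "regular_normalizer G k = normalizer (BijGroup (copies G k)) (right_regular G k)"

definition digraph_image :: "('v \<Rightarrow> 'v) \<Rightarrow> 'v pair_pre_digraph \<Rightarrow> 'v pair_pre_digraph" where
  "digraph_image n \<Gamma> =
    \<lparr> pverts = pverts \<Gamma>, parcs = {(n u, n v) | u v. (u, v) \<in> parcs \<Gamma>} \<rparr>"

text \<open>On digraphs of the form \<^term>\<open>with_proj \<Gamma>\<close> the arc map of a library isomorphism is
  forced to be \<open>(u, v) \<mapsto> (f u, f v)\<close>, where \<open>f\<close> is its vertex map.\<close>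

definition copy_preserving_iso ::
  "('a, 'b) monoid_scheme \<Rightarrow> nat \<Rightarrow>
    ('a \<times> nat) pair_pre_digraph \<Rightarrow> ('a \<times> nat) pair_pre_digraph \<Rightarrow> bool" where
  "copy_preserving_iso G k \<Gamma> \<Sigma> \<longleftrightarrow>
    (\<exists>h. pre_digraph.digraph_isomorphism (with_proj \<Gamma>) h \<and>
         with_proj \<Sigma> = app_iso h (with_proj \<Gamma>) \<and>
         (\<forall>i\<in>{1..k}. \<exists>j\<in>{1..k}. iso_verts h ` copy G i = copy G j))"

text \<open>In the next two definitions \<open>\<C>\<close> is the class in which the competitors \<open>\<Sigma>\<close> of \<open>\<Gamma>\<close> live:
  all \<open>k\<close>-(P)Cayley digraphs for the digraph notions, only the symmetric ones for the
  graph notions.\<close>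

definition CI_within ::
  "('a \<times> nat) pair_pre_digraph set \<Rightarrow> ('a, 'b) monoid_scheme \<Rightarrow> nat \<Rightarrow>
    ('a \<times> nat) pair_pre_digraph \<Rightarrow> bool" where
  "CI_within \<C> G k \<Gamma> \<longleftrightarrow>
    (\<forall>\<Sigma>\<in>\<C>. digraph_iso (with_proj \<Gamma>) (with_proj \<Sigma>) \<longrightarrow>
      (\<exists>n\<in>regular_normalizer G k. digraph_image n \<Gamma> = \<Sigma>))"

definition PCI_within ::
  "('a \<times> nat) pair_pre_digraph set \<Rightarrow> ('a, 'b) monoid_scheme \<Rightarrow> nat \<Rightarrow>
    ('a \<times> nat) pair_pre_digraph \<Rightarrow> bool" where
  "PCI_within \<C> G k \<Gamma> \<longleftrightarrow>
    (\<forall>\<Sigma>\<in>\<C>. copy_preserving_iso G k \<Gamma> \<Sigma> \<longrightarrow>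
      (\<exists>n\<in>regular_normalizer G k. digraph_image n \<Gamma> = \<Sigma>))"

definition DCI_group :: "nat \<Rightarrow> ('a, 'b) monoid_scheme \<Rightarrow> bool" where
  "DCI_group k G \<longleftrightarrow> (\<forall>\<Gamma>\<in>cayley_digraphs G k. CI_within (cayley_digraphs G k) G k \<Gamma>)"

definition CI_group :: "nat \<Rightarrow> ('a, 'b) monoid_scheme \<Rightarrow> bool" where
  "CI_group k G \<longleftrightarrow> (\<forall>\<Gamma>\<in>cayley_graphs G k. CI_within (cayley_graphs G k) G k \<Gamma>)"

definition PDCI_group :: "nat \<Rightarrow> ('a, 'b) monoid_scheme \<Rightarrow> bool" where
  "PDCI_group k G \<longleftrightarrow> (\<forall>\<Gamma>\<in>pcayley_digraphs G k. PCI_within (pcayley_digraphs G k) G k \<Gamma>)"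

definition PCI_group :: "nat \<Rightarrow> ('a, 'b) monoid_scheme \<Rightarrow> bool" where
  "PCI_group k G \<longleftrightarrow> (\<forall>\<Gamma>\<in>pcayley_graphs G k. PCI_within (pcayley_graphs G k) G k \<Gamma>)"

end

theory Submission
  imports Defs "HOL-Combinatorics.Transposition"
begin

text \<open>
  Write \<open>m = k + 1\<close>. A \<open>k\<close>-Cayley digraph \<open>\<Gamma>\<close> becomes an \<open>m\<close>-Cayley digraph when the copy
  \<open>G\<^sub>m\<close> is added as a set of isolated vertices, and this padding preserves symmetry, empty
  diagonal connection sets, and (copy-preserving) isomorphism, because an isomorphism can be
  extended by the identity on \<open>G\<^sub>m\<close>. So if \<open>\<Gamma>\<close> and \<open>\<Sigma>\<close> are isomorphic, the property of \<open>G\<close>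
  for \<open>m\<close> provides an element \<open>n\<close> of the normalizer that carries the padded \<open>\<Gamma>\<close> to the
  padded \<open>\<Sigma>\<close>.

  This \<open>n\<close> need not fix \<open>G\<^sub>m\<close>. But it permutes the orbits of \<open>R(G)\<close>, which are the copies, so
  it maps \<open>G\<^sub>m\<close> onto some \<open>G\<^sub>j\<close>, and then \<open>G\<^sub>j\<close> consists of isolated vertices of the padded
  \<open>\<Sigma>\<close>, just like \<open>G\<^sub>m\<close>. The permutation that swaps these two copies centralizes \<open>R(G)\<close> and is
  an automorphism of the padded \<open>\<Sigma>\<close>. Hence \<open>n\<close> followed by the swap still lies in the normalizer
  and still carries one padded digraph to the other, and now it fixes \<open>G\<^sub>m\<close> setwise; its
  restriction to the first \<open>k\<close> copies carries \<open>\<Gamma>\<close> to \<open>\<Sigma>\<close> and normalizes \<open>R(G)\<close> there.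
  The same argument serves all four properties; the step from the normalizer on \<open>m\<close> copies to
  that on \<open>k\<close> copies is the lemma \<open>normalizer_map_descends\<close>.
\<close>

section \<open>The normalizer of the right regular group, pointwise\<close>

lemma (in group) mem_normalizer_iff_cosets:
  assumes H: "H \<subseteq> carrier G"
  shows "n \<in> normalizer G H \<longleftrightarrow> n \<in> carrier G \<and> n <# H = H #> n"
proof -
  have "n <# H #> inv n = H \<longleftrightarrow> n <# H = H #> n" if n: "n \<in> carrier G"
  proof
    have nH: "n <# H \<subseteq> carrier G"
      using H n by (rule l_coset_subset_G)
    show "n <# H = H #> n" if "n <# H #> inv n = H"
      using coset_mult_assoc[OF nH, of "inv n" n] coset_mult_one[OF nH] n that by simp
    show "n <# H #> inv n = H" if "n <# H = H #> n"
      using coset_mult_assoc[OF H, of n "inv n"] coset_mult_one[OF H] n that by simp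
  qed
  with H show ?thesis
    by (auto simp: normalizer_def stabilizer_def)
qed

abbreviation translate :: "('a, 'b) monoid_scheme \<Rightarrow> 'a \<Rightarrow> 'a \<times> nat \<Rightarrow> 'a \<times> nat" where
  "translate G g v \<equiv> (fst v \<otimes>\<^bsub>G\<^esub> g, snd v)"

lemma mem_copies_iff: "v \<in> copies G k \<longleftrightarrow> fst v \<in> carrier G \<and> snd v \<in> {1..k}"
  by (cases v) (auto simp: copies_def copy_def)

lemma mem_copy_iff: "v \<in> copy G i \<longleftrightarrow> fst v \<in> carrier G \<and> snd v = i"
  by (cases v) (auto simp: copy_def)

lemma copies_Suc: "copies G (Suc k) = copies G k \<union> copy G (Suc k)"
  by (auto simp: mem_copies_iff mem_copy_iff)

lemma copies_disjoint_copy_Suc: "copies G k \<inter> copy G (Suc k) = {}"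
  by (auto simp: mem_copies_iff mem_copy_iff)

lemma right_translation_apply:
  "v \<in> copies G k \<Longrightarrow> right_translation G k g v = translate G g v"
  by (cases v) (simp add: right_translation_def)

lemma right_translation_Bij:
  assumes "group G" and g: "g \<in> carrier G"
  shows "right_translation G k g \<in> Bij (copies G k)"
proof -
  interpret group G by fact
  have "bij_betw (right_translation G k g) (copies G k) (copies G k)"
    by (rule bij_betw_byWitness[where f' = "translate G (inv\<^bsub>G\<^esub> g)"])
      (auto simp: right_translation_apply mem_copies_iff m_assoc g)
  then show ?thesis
    by (simp add: Bij_def right_translation_def)
qed

lemma carrier_BijGroup: "carrier (BijGroup S) = Bij S"
  by (simp add: BijGroup_def)

lemma right_regular_subset: "group G \<Longrightarrow> right_regular G k \<subseteq> Bij (copies G k)"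
  by (auto simp: right_regular_def right_translation_Bij)

lemma compose_right_translation_eq_iff:
  assumes "group G" and n: "n \<in> Bij (copies G k)" and g: "g \<in> carrier G"
  shows "compose (copies G k) n (right_translation G k g) =
         compose (copies G k) (right_translation G k h) n \<longleftrightarrow>
         (\<forall>v\<in>copies G k. n (translate G g v) = translate G h (n v))"
proof -
  have "n v \<in> copies G k" if "v \<in> copies G k" for v
    using Bij_imp_funcset[OF n] that by auto
  then show ?thesis
    by (auto simp: compose_def restrict_def fun_eq_iff right_translation_apply)
qed

text \<open>Equality of the cosets \<open>n R(G)\<close> and \<open>R(G) n\<close>, read off on vertices: the two quantifier
  alternations are the two inclusions.\<close>

lemma mem_regular_normalizer_iff:
  assumes G: "group G"
  shows "n \<in> regular_normalizer G k \<longleftrightarrow>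
    n \<in> Bij (copies G k) \<and>
    (\<forall>g\<in>carrier G. \<exists>h\<in>carrier G. \<forall>v\<in>copies G k. n (translate G g v) = translate G h (n v)) \<and>
    (\<forall>h\<in>carrier G. \<exists>g\<in>carrier G. \<forall>v\<in>copies G k. n (translate G g v) = translate G h (n v))"
proof (cases "n \<in> Bij (copies G k)")
  case True
  let ?B = "BijGroup (copies G k)" and ?R = "right_regular G k"
  let ?t = "right_translation G k" and ?c = "compose (copies G k)"
  interpret B: group ?B by (rule group_BijGroup)
  have l: "n <#\<^bsub>?B\<^esub> ?R = (\<lambda>g. ?c n (?t g)) ` carrier G"
    using True right_translation_Bij[OF G]
    by (auto simp: l_coset_def right_regular_def BijGroup_def)
  have r: "?R #>\<^bsub>?B\<^esub> n = (\<lambda>h. ?c (?t h) n) ` carrier G"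
    using True right_translation_Bij[OF G]
    by (auto simp: r_coset_def right_regular_def BijGroup_def)
  have "n \<in> regular_normalizer G k \<longleftrightarrow> n <#\<^bsub>?B\<^esub> ?R = ?R #>\<^bsub>?B\<^esub> n"
    using True right_regular_subset[OF G]
    by (simp add: regular_normalizer_def B.mem_normalizer_iff_cosets carrier_BijGroup)
  also have "\<dots> \<longleftrightarrow>
      (\<forall>g\<in>carrier G. \<exists>h\<in>carrier G. ?c n (?t g) = ?c (?t h) n) \<and>
      (\<forall>h\<in>carrier G. \<exists>g\<in>carrier G. ?c n (?t g) = ?c (?t h) n)"
    unfolding l r by (auto simp: set_eq_iff image_iff) metis+
  finally show ?thesis
    using True by (simp add: compose_right_translation_eq_iff[OF G True] cong: bex_cong)
next
  case False
  interpret B: group "BijGroup (copies G k)" by (rule group_BijGroup)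
  from False show ?thesis
    using right_regular_subset[OF G]
    by (simp add: regular_normalizer_def B.mem_normalizer_iff_cosets carrier_BijGroup)
qed

lemma compose_mem_regular_normalizer:
  assumes G: "group G"
    and p: "p \<in> regular_normalizer G k" and n: "n \<in> regular_normalizer G k"
  shows "compose (copies G k) p n \<in> regular_normalizer G k"
proof -
  interpret B: group "BijGroup (copies G k)" by (rule group_BijGroup)
  have "subgroup (regular_normalizer G k) (BijGroup (copies G k))"
    unfolding regular_normalizer_def
    using right_regular_subset[OF G] by (intro B.normalizer_imp_subgroup) (simp add: carrier_BijGroup)
  from subgroup.m_closed[OF this p n] show ?thesis
    using p n by (simp add: BijGroup_def mem_regular_normalizer_iff[OF G])
qed

text \<open>A copy is an \<open>R(G)\<close>-orbit, and normalizing permutations permute orbits.\<close>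

lemma regular_normalizer_image_copy:
  assumes G: "group G" and n: "n \<in> regular_normalizer G k" and i: "i \<in> {1..k}"
  obtains j where "j \<in> {1..k}" "n ` copy G i = copy G j"
proof -
  interpret group G by fact
  note N = n[unfolded mem_regular_normalizer_iff[OF G]]
  obtain a j where aj: "n (\<one>\<^bsub>G\<^esub>, i) = (a, j)"
    by fastforce
  have base: "(\<one>\<^bsub>G\<^esub>, i) \<in> copies G k"
    using i by (simp add: mem_copies_iff)
  have "n (\<one>\<^bsub>G\<^esub>, i) \<in> copies G k"
    using N base Bij_imp_funcset[of n "copies G k"] by blast
  then have a: "a \<in> carrier G" and j: "j \<in> {1..k}"
    using aj by (auto simp: mem_copies_iff)
  have into: "n (x, i) \<in> copy G j" if x: "x \<in> carrier G" for x
  proof -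
    obtain h where "h \<in> carrier G" "n (translate G x (\<one>\<^bsub>G\<^esub>, i)) = translate G h (n (\<one>\<^bsub>G\<^esub>, i))"
      using N x base by blast
    then show ?thesis
      using a x by (simp add: aj mem_copy_iff)
  qed
  have onto: "(y, j) \<in> n ` copy G i" if y: "y \<in> carrier G" for y
  proof -
    have "inv\<^bsub>G\<^esub> a \<otimes>\<^bsub>G\<^esub> y \<in> carrier G"
      using a y by simp
    then obtain g where g: "g \<in> carrier G"
      "n (translate G g (\<one>\<^bsub>G\<^esub>, i)) = translate G (inv\<^bsub>G\<^esub> a \<otimes>\<^bsub>G\<^esub> y) (n (\<one>\<^bsub>G\<^esub>, i))"
      using N base by blast
    then have "n (g, i) = (y, j)"
      using a y by (simp add: aj m_assoc[symmetric])
    moreover have "(g, i) \<in> copy G i"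
      using g(1) by (simp add: mem_copy_iff)
    ultimately show ?thesis
      by (metis imageI)
  qed
  have "n ` copy G i \<subseteq> copy G j"
    using into by (auto simp: mem_copy_iff)
  moreover have "copy G j \<subseteq> n ` copy G i"
    using onto by (auto simp: mem_copy_iff)
  ultimately have "n ` copy G i = copy G j"
    by blast
  with j show thesis
    by (rule that)
qed

definition swap_copies ::
  "('a, 'b) monoid_scheme \<Rightarrow> nat \<Rightarrow> nat \<Rightarrow> nat \<Rightarrow> 'a \<times> nat \<Rightarrow> 'a \<times> nat" where
  "swap_copies G k i j = (\<lambda>v\<in>copies G k. (fst v, transpose i j (snd v)))"

text \<open>Swapping two copies commutes with every right translation.\<close>

lemma swap_copies_mem_regular_normalizer:
  assumes G: "group G" and ij: "i \<in> {1..k}" "j \<in> {1..k}"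
  shows "swap_copies G k i j \<in> regular_normalizer G k"
proof -
  interpret group G by fact
  have "bij_betw (swap_copies G k i j) (copies G k) (copies G k)"
    by (rule bij_betw_byWitness[where f' = "swap_copies G k i j"])
      (use ij in \<open>auto simp: swap_copies_def mem_copies_iff transpose_def\<close>)
  then have "swap_copies G k i j \<in> Bij (copies G k)"
    by (simp add: Bij_def swap_copies_def)
  moreover have "swap_copies G k i j (translate G g v) = translate G g (swap_copies G k i j v)"
    if "g \<in> carrier G" "v \<in> copies G k" for g v
    using that by (simp add: swap_copies_def mem_copies_iff)
  ultimately show ?thesis
    unfolding mem_regular_normalizer_iff[OF G] by blast
qed

lemma restrict_mem_regular_normalizer:
  assumes G: "group G" and n: "n \<in> regular_normalizer G (Suc k)"
    and fix_last: "n ` copy G (Suc k) = copy G (Suc k)"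
  shows "restrict n (copies G k) \<in> regular_normalizer G k"
proof -
  interpret group G by fact
  note N = n[unfolded mem_regular_normalizer_iff[OF G]]
  have sub: "copies G k \<subseteq> copies G (Suc k)"
    by (auto simp: copies_Suc)
  have bij: "bij_betw n (copies G (Suc k)) (copies G (Suc k))"
    using N by (simp add: Bij_def)
  have "bij_betw n (copies G (Suc k) - copy G (Suc k)) (copies G (Suc k) - copy G (Suc k))"
    using bij fix_last by (intro bij_betw_DiffI) (auto simp: copies_Suc bij_betw_def inj_on_Un)
  moreover have "copies G (Suc k) - copy G (Suc k) = copies G k"
    using copies_disjoint_copy_Suc[of G k] by (auto simp: copies_Suc)
  ultimately have "restrict n (copies G k) \<in> Bij (copies G k)"
    by (simp add: Bij_def)
  moreover have "\<forall>v\<in>copies G k. restrict n (copies G k) (translate G g v) =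
      translate G h (restrict n (copies G k) v)"
    if "g \<in> carrier G" "\<forall>v\<in>copies G (Suc k). n (translate G g v) = translate G h (n v)" for g h
    using that sub by (auto simp: mem_copies_iff)
  ultimately show ?thesis
    unfolding mem_regular_normalizer_iff[OF G]
    using N by meson
qed

section \<open>Padding by an isolated copy\<close>

definition pad ::
  "('a, 'b) monoid_scheme \<Rightarrow> nat \<Rightarrow> ('a \<times> nat) pair_pre_digraph \<Rightarrow> ('a \<times> nat) pair_pre_digraph" where
  "pad G k \<Gamma> = \<lparr>pverts = copies G (Suc k), parcs = parcs \<Gamma>\<rparr>"

lemma pad_simps [simp]:
  "pverts (pad G k \<Gamma>) = copies G (Suc k)" "parcs (pad G k \<Gamma>) = parcs \<Gamma>"
  by (simp_all add: pad_def)

definition digraph_on_copies ::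
  "('a, 'b) monoid_scheme \<Rightarrow> nat \<Rightarrow> ('a \<times> nat) pair_pre_digraph \<Rightarrow> bool" where
  "digraph_on_copies G k \<Gamma> \<longleftrightarrow>
    pverts \<Gamma> = copies G k \<and> parcs \<Gamma> \<subseteq> copies G k \<times> copies G k"

lemma wf_digraph_with_proj_iff:
  "wf_digraph (with_proj \<Gamma>) \<longleftrightarrow> parcs \<Gamma> \<subseteq> pverts \<Gamma> \<times> pverts \<Gamma>"
  by (auto simp: wf_digraph_def)

text \<open>The arcs of \<^term>\<open>with_proj \<Gamma>\<close> are determined by their end points, so its isomorphisms
  are determined by their vertex maps.\<close>

lemma ex_iso_with_verts_map_iff:
  fixes \<Gamma> :: "'u pair_pre_digraph" and \<Sigma> :: "'v pair_pre_digraph"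
  shows "(\<exists>h. pre_digraph.digraph_isomorphism (with_proj \<Gamma>) h \<and>
              with_proj \<Sigma> = app_iso h (with_proj \<Gamma>) \<and> iso_verts h = f) \<longleftrightarrow>
         wf_digraph (with_proj \<Gamma>) \<and> inj_on f (pverts \<Gamma>) \<and>
         pverts \<Sigma> = f ` pverts \<Gamma> \<and> parcs \<Sigma> = map_prod f f ` parcs \<Gamma>"
    (is "?L \<longleftrightarrow> ?R")
proof
  assume ?L
  then obtain h where h: "pre_digraph.digraph_isomorphism (with_proj \<Gamma>) h"
    and app: "with_proj \<Sigma> = app_iso h (with_proj \<Gamma>)" and f: "iso_verts h = f"
    by blast
  note eqs = arg_cong[OF app, of verts] arg_cong[OF app, of arcs]
    arg_cong[OF app, of tail] arg_cong[OF app, of head]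
  have "iso_arcs h e = map_prod f f e" if "e \<in> parcs \<Gamma>" for e
    using h that eqs(3,4) f
    by (intro prod_eqI) (auto simp: pre_digraph.digraph_isomorphism_def)
  then have "parcs \<Sigma> = map_prod f f ` parcs \<Gamma>"
    using eqs(2) by simp
  then show ?R
    using h eqs f by (auto simp: pre_digraph.digraph_isomorphism_def)
next
  assume R: ?R
  let ?h = "\<lparr>iso_verts = f, iso_arcs = map_prod f f, iso_head = snd, iso_tail = fst\<rparr>"
  have "inj_on (map_prod f f) (parcs \<Gamma>)"
    using R map_prod_inj_on[of f "pverts \<Gamma>" f "pverts \<Gamma>"]
    by (auto simp: wf_digraph_with_proj_iff intro: inj_on_subset)
  then have "pre_digraph.digraph_isomorphism (with_proj \<Gamma>) ?h"
    using R by (simp add: pre_digraph.digraph_isomorphism_def)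
  moreover have "with_proj \<Sigma> = app_iso ?h (with_proj \<Gamma>)"
    using R by (simp add: with_proj_def app_iso_def)
  ultimately show ?L
    by (intro exI[of _ ?h]) simp
qed

lemma pad_iso:
  assumes \<Gamma>: "digraph_on_copies G k \<Gamma>" and \<Sigma>: "digraph_on_copies G k \<Sigma>"
    and h: "pre_digraph.digraph_isomorphism (with_proj \<Gamma>) h"
    and app: "with_proj \<Sigma> = app_iso h (with_proj \<Gamma>)"
  obtains h' where "pre_digraph.digraph_isomorphism (with_proj (pad G k \<Gamma>)) h'"
    and "with_proj (pad G k \<Sigma>) = app_iso h' (with_proj (pad G k \<Gamma>))"
    and "\<And>v. v \<in> copies G k \<Longrightarrow> iso_verts h' v = iso_verts h v"
    and "\<And>v. v \<in> copy G (Suc k) \<Longrightarrow> iso_verts h' v = v"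
proof -
  define f where "f = iso_verts h"
  define f' where "f' v = (if v \<in> copies G k then f v else v)" for v
  have "\<exists>h. pre_digraph.digraph_isomorphism (with_proj \<Gamma>) h \<and>
            with_proj \<Sigma> = app_iso h (with_proj \<Gamma>) \<and> iso_verts h = f"
    using h app f_def by blast
  then have inj: "inj_on f (copies G k)" and im: "f ` copies G k = copies G k"
    and arcs: "parcs \<Sigma> = map_prod f f ` parcs \<Gamma>"
    using \<Gamma> \<Sigma> unfolding ex_iso_with_verts_map_iff digraph_on_copies_def by auto
  have last: "f' v = v" if "v \<in> copy G (Suc k)" for v
    using that copies_disjoint_copy_Suc[of G k] by (auto simp: f'_def)
  have im': "f' ` copies G k = copies G k" "f' ` copy G (Suc k) = copy G (Suc k)"
    using im last by (simp_all add: f'_def)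
  have "inj_on f' (copies G (Suc k))"
    unfolding copies_Suc
  proof (subst inj_on_Un, intro conjI)
    show "inj_on f' (copies G k)"
      using inj by (simp add: f'_def cong: inj_on_cong)
    show "inj_on f' (copy G (Suc k))"
      using last by (simp cong: inj_on_cong)
    have "f' ` (copies G k - copy G (Suc k)) \<subseteq> copies G k"
      "f' ` (copy G (Suc k) - copies G k) \<subseteq> copy G (Suc k)"
      using im' by blast+
    then show "f' ` (copies G k - copy G (Suc k)) \<inter> f' ` (copy G (Suc k) - copies G k) = {}"
      using copies_disjoint_copy_Suc[of G k] by blast
  qed
  moreover have "f' ` copies G (Suc k) = copies G (Suc k)"
    by (simp add: copies_Suc image_Un im')
  moreover have "map_prod f' f' ` parcs \<Gamma> = map_prod f f ` parcs \<Gamma>"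
    using \<Gamma> by (intro image_cong) (auto simp: digraph_on_copies_def f'_def)
  moreover have "wf_digraph (with_proj (pad G k \<Gamma>))"
    using \<Gamma> by (auto simp: wf_digraph_with_proj_iff digraph_on_copies_def copies_Suc)
  ultimately have "\<exists>h'. pre_digraph.digraph_isomorphism (with_proj (pad G k \<Gamma>)) h' \<and>
      with_proj (pad G k \<Sigma>) = app_iso h' (with_proj (pad G k \<Gamma>)) \<and> iso_verts h' = f'"
    unfolding ex_iso_with_verts_map_iff using arcs by simp
  then obtain h' where h': "pre_digraph.digraph_isomorphism (with_proj (pad G k \<Gamma>)) h'"
    "with_proj (pad G k \<Sigma>) = app_iso h' (with_proj (pad G k \<Gamma>))" and verts: "iso_verts h' = f'"
    by blast
  show thesis
  proof (rule that[OF h'])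
    show "iso_verts h' v = iso_verts h v" if "v \<in> copies G k" for v
      using that by (simp add: verts f'_def f_def)
    show "iso_verts h' v = v" if "v \<in> copy G (Suc k)" for v
      using that by (simp add: verts last)
  qed
qed

lemma digraph_iso_pad:
  assumes "digraph_on_copies G k \<Gamma>" "digraph_on_copies G k \<Sigma>"
    and "digraph_iso (with_proj \<Gamma>) (with_proj \<Sigma>)"
  shows "digraph_iso (with_proj (pad G k \<Gamma>)) (with_proj (pad G k \<Sigma>))"
  using assms unfolding digraph_iso_def by (metis pad_iso)

lemma copy_preserving_iso_pad:
  assumes "digraph_on_copies G k \<Gamma>" "digraph_on_copies G k \<Sigma>"
    and "copy_preserving_iso G k \<Gamma> \<Sigma>"
  shows "copy_preserving_iso G (Suc k) (pad G k \<Gamma>) (pad G k \<Sigma>)"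
proof -
  from assms(3) obtain h where h: "pre_digraph.digraph_isomorphism (with_proj \<Gamma>) h"
      "with_proj \<Sigma> = app_iso h (with_proj \<Gamma>)"
    and perm: "\<forall>i\<in>{1..k}. \<exists>j\<in>{1..k}. iso_verts h ` copy G i = copy G j"
    unfolding copy_preserving_iso_def by blast
  from pad_iso[OF assms(1,2) h] obtain h'
    where h': "pre_digraph.digraph_isomorphism (with_proj (pad G k \<Gamma>)) h'"
      "with_proj (pad G k \<Sigma>) = app_iso h' (with_proj (pad G k \<Gamma>))"
      and old: "\<And>v. v \<in> copies G k \<Longrightarrow> iso_verts h' v = iso_verts h v"
      and last: "\<And>v. v \<in> copy G (Suc k) \<Longrightarrow> iso_verts h' v = v"
    by blast
  have "\<exists>j\<in>{1..Suc k}. iso_verts h' ` copy G i = copy G j" if i: "i \<in> {1..Suc k}" for i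
  proof (cases "i = Suc k")
    case True
    have "iso_verts h' ` copy G (Suc k) = copy G (Suc k)"
      using last by simp
    with True i show ?thesis
      by blast
  next
    case False
    with i have i': "i \<in> {1..k}"
      by simp
    then have "copy G i \<subseteq> copies G k"
      by (auto simp: copies_def)
    then have "iso_verts h' ` copy G i = iso_verts h ` copy G i"
      using old by (intro image_cong) auto
    moreover obtain j where "j \<in> {1..k}" "iso_verts h ` copy G i = copy G j"
      using perm i' by blast
    ultimately show ?thesis
      by (intro bexI[of _ j]) auto
  qed
  with h' show ?thesis
    unfolding copy_preserving_iso_def by blast
qed

section \<open>Descent to fewer copies\<close>

lemma digraph_image_eq_iff:
  "digraph_image n \<Gamma> = \<Sigma> \<longleftrightarrow> pverts \<Sigma> = pverts \<Gamma> \<and> parcs \<Sigma> = map_prod n n ` parcs \<Gamma>"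
proof -
  have "{(n u, n v) |u v. (u, v) \<in> parcs \<Gamma>} = map_prod n n ` parcs \<Gamma>"
    by force
  then show ?thesis
    by (cases \<Sigma>) (auto simp: digraph_image_def)
qed

text \<open>The image of the added copy consists of isolated vertices of the padded \<open>\<Sigma>\<close>, as the added
  copy itself does, so swapping the two disturbs no arc.\<close>

lemma normalizer_map_descends:
  assumes G: "group G"
    and \<Gamma>: "digraph_on_copies G k \<Gamma>" and \<Sigma>: "digraph_on_copies G k \<Sigma>"
    and n: "n \<in> regular_normalizer G (Suc k)"
    and im: "digraph_image n (pad G k \<Gamma>) = pad G k \<Sigma>"
  shows "\<exists>r\<in>regular_normalizer G k. digraph_image r \<Gamma> = \<Sigma>"
proof -
  obtain j where j: "j \<in> {1..Suc k}" and nj: "n ` copy G (Suc k) = copy G j"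
    using regular_normalizer_image_copy[OF G n, of "Suc k"] by auto
  define s where "s = swap_copies G (Suc k) j (Suc k)"
  define p where "p = compose (copies G (Suc k)) s n"
  have p: "p \<in> regular_normalizer G (Suc k)"
    unfolding p_def s_def using G n j
    by (simp add: compose_mem_regular_normalizer swap_copies_mem_regular_normalizer)
  have ninj: "inj_on n (copies G (Suc k))"
    using n by (simp add: mem_regular_normalizer_iff[OF G] Bij_def bij_betw_def)
  have arcs: "parcs \<Sigma> = map_prod n n ` parcs \<Gamma>"
    using im by (simp add: digraph_image_eq_iff)
  have p_eq: "p v = s (n v)" if "v \<in> copies G (Suc k)" for v
    using that by (simp add: p_def compose_def)
  \<comment> \<open>\<open>n\<close> can send a vertex of \<open>\<Gamma>\<close> into the added copy, but not one that lies on an arc, since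
    \<open>\<Sigma>\<close> has no arcs there; nor into \<open>copy G j\<close>, the image of the added copy. So on such vertices
    the swap does nothing and \<open>p\<close> agrees with \<open>n\<close>.\<close>
  have p_n: "p v = n v" if v: "v \<in> copies G k" and nv: "n v \<in> copies G k" for v
  proof -
    have "n v \<notin> copy G j"
    proof
      assume "n v \<in> copy G j"
      then obtain w where w: "w \<in> copy G (Suc k)" "n v = n w"
        using nj by blast
      then have "v = w"
        using ninj v by (auto simp: copies_Suc dest: inj_onD)
      then show False
        using v w(1) copies_disjoint_copy_Suc[of G k] by blast
    qed
    then have "snd (n v) \<noteq> j" "snd (n v) \<noteq> Suc k"
      using nv by (auto simp: mem_copy_iff mem_copies_iff)
    then have "s (n v) = n v"
      using nv by (simp add: s_def swap_copies_def copies_Suc)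
    then show ?thesis
      using v by (simp add: p_eq copies_Suc)
  qed
  have "s ` copy G j = copy G (Suc k)"
  proof -
    have "s (x, j) = (x, Suc k)" if "x \<in> carrier G" for x
      using that j by (simp add: s_def swap_copies_def mem_copies_iff)
    then show ?thesis
      by (auto simp: copy_def image_iff)
  qed
  moreover have "p ` copy G (Suc k) = s ` n ` copy G (Suc k)"
    by (simp add: image_image p_eq copies_Suc)
  ultimately have "p ` copy G (Suc k) = copy G (Suc k)"
    by (simp add: nj)
  then have r: "restrict p (copies G k) \<in> regular_normalizer G k"
    by (rule restrict_mem_regular_normalizer[OF G p])
  have "map_prod (restrict p (copies G k)) (restrict p (copies G k)) e = map_prod n n e"
    if e: "e \<in> parcs \<Gamma>" for e
  proof -
    have "map_prod n n e \<in> copies G k \<times> copies G k"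
      using e arcs \<Sigma> by (auto simp: digraph_on_copies_def)
    moreover have "e \<in> copies G k \<times> copies G k"
      using e \<Gamma> by (auto simp: digraph_on_copies_def)
    ultimately show ?thesis
      by (cases e) (simp add: p_n)
  qed
  then have "digraph_image (restrict p (copies G k)) \<Gamma> = \<Sigma>"
    using arcs \<Gamma> \<Sigma> unfolding digraph_image_eq_iff by (simp add: digraph_on_copies_def)
  with r show ?thesis
    by blast
qed

lemma CI_within_pad_imp:
  assumes "group G"
    and on: "\<And>\<Sigma>. \<Sigma> \<in> \<C> \<Longrightarrow> digraph_on_copies G k \<Sigma>"
    and pad: "\<And>\<Sigma>. \<Sigma> \<in> \<C> \<Longrightarrow> pad G k \<Sigma> \<in> \<C>'"
    and "\<Gamma> \<in> \<C>" and "CI_within \<C>' G (Suc k) (pad G k \<Gamma>)"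
  shows "CI_within \<C> G k \<Gamma>"
  unfolding CI_within_def
proof (intro ballI impI)
  fix \<Sigma> assume \<Sigma>: "\<Sigma> \<in> \<C>" and iso: "digraph_iso (with_proj \<Gamma>) (with_proj \<Sigma>)"
  have "digraph_iso (with_proj (pad G k \<Gamma>)) (with_proj (pad G k \<Sigma>))"
    by (rule digraph_iso_pad[OF on[OF \<open>\<Gamma> \<in> \<C>\<close>] on[OF \<Sigma>] iso])
  with assms(5) pad[OF \<Sigma>] obtain n
    where "n \<in> regular_normalizer G (Suc k)" "digraph_image n (pad G k \<Gamma>) = pad G k \<Sigma>"
    unfolding CI_within_def by metis
  then show "\<exists>n\<in>regular_normalizer G k. digraph_image n \<Gamma> = \<Sigma>"
    by (rule normalizer_map_descends[OF \<open>group G\<close> on[OF \<open>\<Gamma> \<in> \<C>\<close>] on[OF \<Sigma>]])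
qed

lemma PCI_within_pad_imp:
  assumes "group G"
    and on: "\<And>\<Sigma>. \<Sigma> \<in> \<C> \<Longrightarrow> digraph_on_copies G k \<Sigma>"
    and pad: "\<And>\<Sigma>. \<Sigma> \<in> \<C> \<Longrightarrow> pad G k \<Sigma> \<in> \<C>'"
    and "\<Gamma> \<in> \<C>" and "PCI_within \<C>' G (Suc k) (pad G k \<Gamma>)"
  shows "PCI_within \<C> G k \<Gamma>"
  unfolding PCI_within_def
proof (intro ballI impI)
  fix \<Sigma> assume \<Sigma>: "\<Sigma> \<in> \<C>" and iso: "copy_preserving_iso G k \<Gamma> \<Sigma>"
  have "copy_preserving_iso G (Suc k) (pad G k \<Gamma>) (pad G k \<Sigma>)"
    by (rule copy_preserving_iso_pad[OF on[OF \<open>\<Gamma> \<in> \<C>\<close>] on[OF \<Sigma>] iso])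
  with assms(5) pad[OF \<Sigma>] obtain n
    where "n \<in> regular_normalizer G (Suc k)" "digraph_image n (pad G k \<Gamma>) = pad G k \<Sigma>"
    unfolding PCI_within_def by metis
  then show "\<exists>n\<in>regular_normalizer G k. digraph_image n \<Gamma> = \<Sigma>"
    by (rule normalizer_map_descends[OF \<open>group G\<close> on[OF \<open>\<Gamma> \<in> \<C>\<close>] on[OF \<Sigma>]])
qed

section \<open>The four classes are closed under padding\<close>

lemma digraph_on_copies_Cay:
  assumes "group G" and "\<forall>i\<in>{1..k}. \<forall>j\<in>{1..k}. S i j \<subseteq> carrier G"
  shows "digraph_on_copies G k (Cay G k S)"
proof -
  interpret group G by fact
  show ?thesis
    using assms(2) by (auto simp: digraph_on_copies_def Cay_def mem_copies_iff subset_iff)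
qed

lemma pad_Cay:
  "pad G k (Cay G k S) = Cay G (Suc k) (\<lambda>i j. if i \<le> k \<and> j \<le> k then S i j else {})"
proof -
  have "parcs (Cay G k S) = parcs (Cay G (Suc k) (\<lambda>i j. if i \<le> k \<and> j \<le> k then S i j else {}))"
    by (auto simp: Cay_def split: if_splits) (force simp: Bex_def)+
  then show ?thesis
    by (simp add: pad_def Cay_def)
qed

lemma cayley_digraphs_on_copies:
  "group G \<Longrightarrow> \<Gamma> \<in> cayley_digraphs G k \<Longrightarrow> digraph_on_copies G k \<Gamma>"
  unfolding cayley_digraphs_def using digraph_on_copies_Cay by blast

lemma pcayley_digraphs_on_copies:
  "group G \<Longrightarrow> \<Gamma> \<in> pcayley_digraphs G k \<Longrightarrow> digraph_on_copies G k \<Gamma>"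
  unfolding pcayley_digraphs_def using digraph_on_copies_Cay by blast

lemma pad_cayley_digraphs:
  assumes "\<Gamma> \<in> cayley_digraphs G k"
  shows "pad G k \<Gamma> \<in> cayley_digraphs G (Suc k)"
proof -
  from assms obtain S where "\<Gamma> = Cay G k S"
    and "\<forall>i\<in>{1..k}. \<forall>j\<in>{1..k}. S i j \<subseteq> carrier G" "\<forall>i\<in>{1..k}. \<one>\<^bsub>G\<^esub> \<notin> S i i"
    unfolding cayley_digraphs_def by blast
  then show ?thesis
    unfolding cayley_digraphs_def
    by (intro CollectI exI[of _ "\<lambda>i j. if i \<le> k \<and> j \<le> k then S i j else {}"]) (simp add: pad_Cay)
qed

lemma pad_pcayley_digraphs:
  assumes "\<Gamma> \<in> pcayley_digraphs G k"
  shows "pad G k \<Gamma> \<in> pcayley_digraphs G (Suc k)"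
proof -
  from assms obtain S where "\<Gamma> = Cay G k S"
    and "\<forall>i\<in>{1..k}. \<forall>j\<in>{1..k}. S i j \<subseteq> carrier G" "\<forall>i\<in>{1..k}. S i i = {}"
    unfolding pcayley_digraphs_def by blast
  then show ?thesis
    unfolding pcayley_digraphs_def
    by (intro CollectI exI[of _ "\<lambda>i j. if i \<le> k \<and> j \<le> k then S i j else {}"]) (simp add: pad_Cay)
qed

lemma symmetric_pad: "symmetric (with_proj (pad G k \<Gamma>)) \<longleftrightarrow> symmetric (with_proj \<Gamma>)"
  by (simp add: symmetric_def)

theorem theorem5p3:
  fixes G :: "('a, 'b) monoid_scheme" and m :: nat
  assumes "group G" and "finite (carrier G)" and "m \<ge> 2"
  shows "(DCI_group m G \<longrightarrow> DCI_group (m - 1) G) \<and>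
         (CI_group m G \<longrightarrow> CI_group (m - 1) G) \<and>
         (PDCI_group m G \<longrightarrow> PDCI_group (m - 1) G) \<and>
         (PCI_group m G \<longrightarrow> PCI_group (m - 1) G)"
proof -
  define k where "k = m - 1"
  have m: "m = Suc k"
    using \<open>m \<ge> 2\<close> by (simp add: k_def)
  have on: "digraph_on_copies G k \<Gamma>" if "\<Gamma> \<in> cayley_graphs G k \<or> \<Gamma> \<in> pcayley_graphs G k" for \<Gamma>
    using that cayley_digraphs_on_copies[OF \<open>group G\<close>] pcayley_digraphs_on_copies[OF \<open>group G\<close>]
    by (auto simp: cayley_graphs_def pcayley_graphs_def)
  have pad_graphs:
    "pad G k \<Gamma> \<in> cayley_graphs G (Suc k)" if "\<Gamma> \<in> cayley_graphs G k" for \<Gamma>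
    using that by (simp add: cayley_graphs_def pad_cayley_digraphs symmetric_pad)
  have pad_pgraphs:
    "pad G k \<Gamma> \<in> pcayley_graphs G (Suc k)" if "\<Gamma> \<in> pcayley_graphs G k" for \<Gamma>
    using that by (simp add: pcayley_graphs_def pad_pcayley_digraphs symmetric_pad)
  have "DCI_group (Suc k) G \<longrightarrow> DCI_group k G"
    unfolding DCI_group_def
    using CI_within_pad_imp[OF \<open>group G\<close> cayley_digraphs_on_copies[OF \<open>group G\<close>] pad_cayley_digraphs]
      pad_cayley_digraphs by blast
  moreover have "CI_group (Suc k) G \<longrightarrow> CI_group k G"
    unfolding CI_group_def
    using CI_within_pad_imp[OF \<open>group G\<close> on pad_graphs] pad_graphs by blast
  moreover have "PDCI_group (Suc k) G \<longrightarrow> PDCI_group k G"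
    unfolding PDCI_group_def
    using PCI_within_pad_imp[OF \<open>group G\<close> pcayley_digraphs_on_copies[OF \<open>group G\<close>] pad_pcayley_digraphs]
      pad_pcayley_digraphs by blast
  moreover have "PCI_group (Suc k) G \<longrightarrow> PCI_group k G"
    unfolding PCI_group_def
    using PCI_within_pad_imp[OF \<open>group G\<close> on pad_pgraphs] pad_pgraphs by blast
  ultimately show ?thesis
    by (simp add: m)
qed

end
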